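(* Let $A\in\mathscr{D}\mathrm{iag}$ with $L(A)>0$. There are constants $\delta=\delta(A)>0$, $c=c(A)>0$ and $C=C(A)<\infty$ such that if $D\in\mathscr{D}\mathrm{iag}$ with $d(D,A)<\delta$, then $$\mathbb{P}\Big[\Big|\tfrac1n\log\|D^{(n)}\|-L(D)\Big|>\varepsilon\Big]\le e^{-c\varepsilon^2n}$$ for all $\varepsilon>0$ and all $n\ge C/\varepsilon$.
   Context: $\mathrm{SL}_2(\mathbb{R})$ denotes real $2\times2$ matrices with determinant $\pm1$. $\Sigma=\{1,\dots,k\}$, $p$ a probability vector with positive entries, $X=\Sigma^{\mathbb{Z}}$, $\mathbb{P}=p^{\mathbb{Z}}$, $T$ the shift. A cocycle $D=(D_1,\dots,D_k)\in\mathrm{SL}_2(\mathbb{R})^k$ acts by $D(x)=D_{x_0}$ with iterates $D^{(n)}(x)=D_{x_{n-1}}\cdots D_{x_0}$; $d(A,D)=\max_j\|A_j-D_j\|$; $L(D)$ is the a.s. limit of $\frac1n\log\|D^{(n)}(x)\|$. $\mathscr{D}\mathrm{iag}$ is the set of cocycles in $\mathrm{SL}_2(\mathbb{R})^k$ admitting two transversal lines each invariant under all $D_j$. *)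

theory Defs
  imports "HOL-Analysis.Analysis" "HOL-Probability.Probability"
begin

type_synonym mat2 = "real^2^2"

definition SL2 :: "mat2 \<Rightarrow> bool" where
  "SL2 M \<longleftrightarrow> det M = 1 \<or> det M = -1"

definition opnorm :: "mat2 \<Rightarrow> real" where
  "opnorm M = onorm (\<lambda>v. M *v v)"

definition Diag :: "('a \<Rightarrow> mat2) \<Rightarrow> bool" where
  "Diag D \<longleftrightarrow> (\<forall>j. SL2 (D j)) \<and>
     (\<exists>u v :: real^2. u \<noteq> 0 \<and> v \<noteq> 0 \<and> span {u} \<inter> span {v} = {0} \<and>
        (\<forall>j. D j *v u \<in> span {u} \<and> D j *v v \<in> span {v}))"

definition coc_dist :: "('a::finite \<Rightarrow> mat2) \<Rightarrow> ('a \<Rightarrow> mat2) \<Rightarrow> real" where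
  "coc_dist A D = Max (range (\<lambda>j. opnorm (A j - D j)))"

fun coc_iter :: "('a \<Rightarrow> mat2) \<Rightarrow> nat \<Rightarrow> (int \<Rightarrow> 'a) \<Rightarrow> mat2" where
  "coc_iter D 0 x = mat 1"
| "coc_iter D (Suc n) x = D (x (int n)) ** coc_iter D n x"

definition bern :: "'a pmf \<Rightarrow> (int \<Rightarrow> 'a) measure" where
  "bern p = PiM (UNIV :: int set) (\<lambda>_. measure_pmf p)"

definition lyap :: "'a pmf \<Rightarrow> ('a \<Rightarrow> mat2) \<Rightarrow> real" where
  "lyap p D = (THE l. AE x in bern p.
      (\<lambda>n. ln (opnorm (coc_iter D n x)) / real n) \<longlonglongrightarrow> l)"

end

theory Submission
  imports Defs "HOL-Probability.Hoeffding"
begin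

text \<open>
  On a common eigenframe the iterate is diagonal with entries of modulus \<open>exp (\<plusminus> S)\<close>, where \<open>S\<close> is
  the Birkhoff sum of \<open>ln \<bar>a\<bar>\<close> for the eigenvalue \<open>a\<close> along the first line. Hence the logarithm of its
  norm is \<open>\<bar>S\<bar>\<close> up to a constant depending only on the angle of the frame, and the Lyapunov exponent
  is the modulus of the mean of \<open>ln \<bar>a\<bar>\<close>. Positivity of the exponent of \<open>A\<close> yields a letter \<open>j\<close> with
  distinct eigenvalues; the gap persists near \<open>A\<close> and bounds the projections of the frame uniformly.

  Hoeffding's inequality has a prefactor 2, which is useless when \<open>\<epsilon>\<^sup>2 n\<close> is small. In that range one
  needs the small ball bound \<open>P (\<bar>S\<bar> \<le> s) \<ge> c s\<^sup>2 / n\<close> for a centred sum \<open>S\<close> and \<open>s\<close> large compared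
  with the step size. It follows by computing \<open>E (S f(S)) = \<Sum> E (X\<^sub>i (f(S) - f(S - X\<^sub>i)))\<close> for the
  truncation \<open>f\<close> at level \<open>t\<close>: the left side is at least \<open>t\<^sup>2 P (\<bar>S\<bar> > t)\<close>, whereas the differences
  on the right vanish unless \<open>\<bar>S\<bar> \<le> t + B\<close>.
\<close>

section \<open>Concentration of centred bounded independent sums, without a prefactor\<close>

lemma (in prob_space) centred_sum_small_ball:
  fixes X :: "'i \<Rightarrow> 'a \<Rightarrow> real"
  assumes fin: "finite I" and indep: "indep_vars (\<lambda>_. borel) X I"
    and bnd: "\<And>i x. i \<in> I \<Longrightarrow> x \<in> space M \<Longrightarrow> \<bar>X i x\<bar> \<le> B"
    and mean: "\<And>i. i \<in> I \<Longrightarrow> expectation (X i) = 0"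
    and t: "t \<ge> 0"
  shows "t\<^sup>2 * prob {x \<in> space M. \<bar>\<Sum>i\<in>I. X i x\<bar> > t}
       \<le> real (card I) * B\<^sup>2 * prob {x \<in> space M. \<bar>\<Sum>i\<in>I. X i x\<bar> \<le> t + B}"
proof -
  define f :: "real \<Rightarrow> real" where "f = (\<lambda>s. max (- t) (min t s))"
  define S where "S = (\<lambda>x. \<Sum>i\<in>I. X i x)"
  have f_meas [measurable]: "f \<in> borel_measurable borel"
    unfolding f_def by measurable
  have f_bnd: "\<bar>f s\<bar> \<le> t" for s
    using t by (auto simp: f_def)
  have X_meas [measurable]: "X i \<in> borel_measurable M" if "i \<in> I" for i
    using indep that by (auto simp: indep_vars_def)
  have S_meas [measurable]: "S \<in> borel_measurable M"
    unfolding S_def by measurable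
  have X_int: "integrable M (X i)" if "i \<in> I" for i
    using bnd[OF that] that by (intro integrable_const_bound[where B = B]) auto
  have fS_int: "integrable M (\<lambda>x. f (S x - g x))" if "g \<in> borel_measurable M" for g
    using f_bnd that by (intro integrable_const_bound[where B = t]) auto
  \<comment> \<open>The shift \<open>g\<close> is left free because both \<open>g\<close> = 0 and
    \<open>g = X i\<close> occur below.\<close>
  have prod_int: "integrable M (\<lambda>x. X i x * f (S x - g x))"
    if i: "i \<in> I" and [measurable]: "g \<in> borel_measurable M" for i g
  proof (rule integrable_const_bound[where B = "B * t"])
    show "AE x in M. norm (X i x * f (S x - g x)) \<le> B * t"
    proof (rule AE_I2)
      fix x assume x: "x \<in> space M"
      have "\<bar>X i x\<bar> * \<bar>f (S x - g x)\<bar> \<le> B * t"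
        using bnd[OF i x] f_bnd[of "S x - g x"] by (intro mult_mono) auto
      then show "norm (X i x * f (S x - g x)) \<le> B * t"
        by (simp add: abs_mult)
    qed
  qed (use i in measurable)
  have lip: "\<bar>f s - f s'\<bar> \<le> \<bar>s - s'\<bar>" for s s'
    by (auto simp: f_def max_def min_def)
  have term_le: "expectation (\<lambda>x. X i x * f (S x)) \<le> B\<^sup>2 * prob {x \<in> space M. \<bar>S x\<bar> \<le> t + B}"
    if i: "i \<in> I" for i
  proof -
    \<comment> \<open>\<open>X i\<close> is independent of the remaining sum \<open>S - X i\<close>
      and centred, so its product with \<open>f (S - X i)\<close> has mean zero and can be
      subtracted at no cost.\<close>
    have "indep_var borel (X i) borel (\<lambda>x. \<Sum>j\<in>I - {i}. X j x)"
      using fin indep i by (intro indep_vars_sum) (auto simp: insert_absorb)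
    then have "indep_var borel (id \<circ> X i) borel (f \<circ> (\<lambda>x. \<Sum>j\<in>I - {i}. X j x))"
      by (rule indep_var_compose) auto
    moreover have "f \<circ> (\<lambda>x. \<Sum>j\<in>I - {i}. X j x) = (\<lambda>x. f (S x - X i x))"
      using fin i by (auto simp: S_def sum_diff1)
    ultimately have ind: "indep_var borel (X i) borel (\<lambda>x. f (S x - X i x))"
      by simp
    have zero: "expectation (\<lambda>x. X i x * f (S x - X i x)) = 0"
      using indep_var_lebesgue_integral[OF ind X_int[OF i] fS_int[OF X_meas[OF i]]] mean[OF i]
      by simp
    have "expectation (\<lambda>x. X i x * f (S x))
        = expectation (\<lambda>x. X i x * f (S x) - X i x * f (S x - X i x))"
      using prod_int[OF i, of "\<lambda>_. 0"] prod_int[OF i X_meas[OF i]] zero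
      by (subst Bochner_Integration.integral_diff) auto
    also have "\<dots> \<le> expectation (\<lambda>x. B\<^sup>2 * indicator {x \<in> space M. \<bar>S x\<bar> \<le> t + B} x)"
    proof (rule integral_mono)
      show "integrable M (\<lambda>x. X i x * f (S x) - X i x * f (S x - X i x))"
        using prod_int[OF i, of "\<lambda>_. 0"] prod_int[OF i X_meas[OF i]] by auto
      show "integrable M (\<lambda>x. B\<^sup>2 * indicator {x \<in> space M. \<bar>S x\<bar> \<le> t + B} x)"
        by (intro integrable_mult_right integrable_real_indicator)
          (auto simp: emeasure_eq_measure)
    next
      fix x assume x: "x \<in> space M"
      note b = bnd[OF i x]
      show "X i x * f (S x) - X i x * f (S x - X i x)
          \<le> B\<^sup>2 * indicator {x \<in> space M. \<bar>S x\<bar> \<le> t + B} x"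
      proof (cases "\<bar>S x\<bar> \<le> t + B")
        case True
        have "X i x * f (S x) - X i x * f (S x - X i x) \<le> \<bar>X i x\<bar> * \<bar>f (S x) - f (S x - X i x)\<bar>"
          by (metis abs_ge_self abs_mult right_diff_distrib)
        also have "\<dots> \<le> B * B"
          using b lip[of "S x" "S x - X i x"] by (intro mult_mono) auto
        finally show ?thesis
          using True x by (simp add: power2_eq_square)
      next
        \<comment> \<open>Here \<open>S x\<close> and \<open>S x - X i x\<close> lie beyond the
          truncation level on the same side, where \<open>f\<close> is constant.\<close>
        case False
        then have "f (S x - X i x) = f (S x)"
          using b by (auto simp: f_def max_def min_def)
        then show ?thesis
          using False by simp
      qed
    qed
    also have "\<dots> = B\<^sup>2 * prob {x \<in> space M. \<bar>S x\<bar> \<le> t + B}"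
      by (simp add: Collect_conj_eq)
    finally show ?thesis .
  qed
  have "t\<^sup>2 * prob {x \<in> space M. \<bar>S x\<bar> > t}
      = expectation (\<lambda>x. t\<^sup>2 * indicator {x \<in> space M. \<bar>S x\<bar> > t} x)"
    by (simp add: Collect_conj_eq)
  also have "\<dots> \<le> expectation (\<lambda>x. \<Sum>i\<in>I. X i x * f (S x))"
  proof (rule integral_mono)
    show "integrable M (\<lambda>x. t\<^sup>2 * indicator {x \<in> space M. \<bar>S x\<bar> > t} x)"
      by (intro integrable_mult_right integrable_real_indicator)
        (auto simp: emeasure_eq_measure)
    show "integrable M (\<lambda>x. \<Sum>i\<in>I. X i x * f (S x))"
      using prod_int[of _ "\<lambda>_. 0"] by auto
  next
    fix x assume x: "x \<in> space M"
    have eq: "(\<Sum>i\<in>I. X i x * f (S x)) = S x * f (S x)"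
      by (simp add: S_def sum_distrib_right)
    \<comment> \<open>Beyond the level, \<open>S * f S\<close> is |S| t, which is at least t^2;
      below it, the product is the square of \<open>S\<close>.\<close>
    consider "S x > t" | "S x < - t" | "\<bar>S x\<bar> \<le> t"
      by linarith
    then show "t\<^sup>2 * indicator {x \<in> space M. \<bar>S x\<bar> > t} x \<le> (\<Sum>i\<in>I. X i x * f (S x))"
    proof cases
      case 1
      then show ?thesis
        unfolding eq using x t by (simp add: f_def power2_eq_square mult_right_mono)
    next
      case 2
      then have "f (S x) = - t" "t * t \<le> (- S x) * t"
        using t mult_right_mono[of t "- S x" t] by (auto simp: f_def)
      with 2 show ?thesis
        unfolding eq using x by (simp add: power2_eq_square)
    next
      case 3
      then show ?thesis
        unfolding eq by (auto simp: f_def)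
    qed
  qed
  also have "\<dots> = (\<Sum>i\<in>I. expectation (\<lambda>x. X i x * f (S x)))"
    using prod_int[of _ "\<lambda>_. 0"] by (intro Bochner_Integration.integral_sum) auto
  also have "\<dots> \<le> (\<Sum>i\<in>I. B\<^sup>2 * prob {x \<in> space M. \<bar>S x\<bar> \<le> t + B})"
    by (intro sum_mono term_le)
  finally show ?thesis
    by (simp add: S_def mult.assoc)
qed

text \<open>Hoeffding gives 2 exp(-2y) with y = s^2 / (4 N B^2), N being the number of summands.
  Giving up three quarters of the exponent absorbs the factor 2 when y is at least 1; for smaller y
  the small ball bound forces enough mass outside the tail event.\<close>

lemma (in prob_space) centred_sum_concentration:
  fixes X :: "'i \<Rightarrow> 'a \<Rightarrow> real"
  assumes fin: "finite I" and I: "I \<noteq> {}" and indep: "indep_vars (\<lambda>_. borel) X I"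
    and bnd: "\<And>i x. i \<in> I \<Longrightarrow> x \<in> space M \<Longrightarrow> \<bar>X i x\<bar> \<le> B"
    and mean: "\<And>i. i \<in> I \<Longrightarrow> expectation (X i) = 0"
    and B: "B > 0" and s: "s \<ge> 2 * B"
  shows "prob {x \<in> space M. \<bar>\<Sum>i\<in>I. X i x\<bar> > s} \<le> exp (- (s\<^sup>2 / (8 * real (card I) * B\<^sup>2)))"
proof -
  have X_meas [measurable]: "X i \<in> borel_measurable M" if "i \<in> I" for i
    using indep that by (auto simp: indep_vars_def)
  define S where "S = (\<lambda>x. \<Sum>i\<in>I. X i x)"
  have S_meas [measurable]: "S \<in> borel_measurable M"
    unfolding S_def by measurable
  define N where "N = real (card I)"
  have N: "N > 0"
    using fin I by (simp add: N_def card_gt_0_iff)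
  define y where "y = s\<^sup>2 / (4 * N * B\<^sup>2)"
  have y: "y > 0"
    using B N s by (auto simp: y_def)
  define q where "q = prob {x \<in> space M. \<bar>S x\<bar> > s}"
  have goal_eq: "s\<^sup>2 / (8 * N * B\<^sup>2) = y / 2"
    by (simp add: y_def)
  have "q \<le> exp (- (y / 2))"
  proof (cases "y \<ge> 1")
    case True
    interpret Hoeffding_ineq M I X "\<lambda>_. - B" "\<lambda>_. B" "\<Sum>i\<in>I. expectation (X i)"
      by unfold_locales (use fin indep bnd in \<open>auto simp: abs_le_iff minus_le_iff\<close>)
    have sum_sq: "(\<Sum>i\<in>I. (B - - B)\<^sup>2) = 4 * N * B\<^sup>2"
      by (simp add: N_def power2_eq_square)
    have "q \<le> prob {x \<in> space M. \<bar>S x\<bar> \<ge> s}"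
      unfolding q_def by (rule finite_measure_mono) auto
    also have "\<dots> \<le> 2 * exp (- 2 * s\<^sup>2 / (4 * N * B\<^sup>2))"
      using Hoeffding_ineq_abs_ge[of s] B s N by (simp only: sum_sq) (simp add: S_def mean)
    also have "\<dots> = 2 * exp (- (2 * y))"
      by (simp add: y_def)
    \<comment> \<open>The prefactor is absorbed through 2 <= 1 + y <= exp y.\<close>
    also have "\<dots> \<le> exp y * exp (- (2 * y))"
      using order_trans[OF _ exp_ge_add_one_self[of y], of 2] True by (intro mult_right_mono) auto
    also have "\<dots> = exp (- y)"
      by (simp flip: exp_add)
    also have "\<dots> \<le> exp (- (y / 2))"
      using y by simp
    finally show ?thesis .
  next
    case False
    \<comment> \<open>As s >= 2B, this level satisfies t + B <= s, so the small ball lies in the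
      complement of the tail event.\<close>
    define t where "t = s / 2"
    have t: "t \<ge> 0" "t + B \<le> s" "t \<le> s"
      using B s by (auto simp: t_def)
    have "t\<^sup>2 * q \<le> t\<^sup>2 * prob {x \<in> space M. \<bar>S x\<bar> > t}"
      unfolding q_def using t by (intro mult_left_mono finite_measure_mono) auto
    also have "\<dots> \<le> N * B\<^sup>2 * prob {x \<in> space M. \<bar>S x\<bar> \<le> t + B}"
      unfolding S_def N_def
      by (rule centred_sum_small_ball[OF fin indep bnd mean t(1)])
    also have "\<dots> \<le> N * B\<^sup>2 * prob {x \<in> space M. \<not> \<bar>S x\<bar> > s}"
      using t N by (intro mult_left_mono finite_measure_mono) auto
    also have "\<dots> = N * B\<^sup>2 * (1 - q)"
      unfolding q_def by (subst prob_neg) auto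
    \<comment> \<open>By the choice of \<open>t\<close>, t^2 = y N B^2, and the factor N B^2
      cancels.\<close>
    finally have "y * q \<le> 1 - q"
      using N B by (simp add: t_def y_def field_simps)
    then have "q * (1 + y) \<le> 1"
      by (simp add: algebra_simps)
    moreover have "exp (y / 2) \<le> 1 + y"
    proof -
      have "exp (y / 2) \<le> 1 + y / 2 + (y / 2)\<^sup>2"
        using y False by (intro exp_bound) auto
      also have "(y / 2)\<^sup>2 \<le> y / 2"
        using y False by (simp add: power2_eq_square mult_le_one)
      finally show ?thesis by simp
    qed
    moreover have "q \<ge> 0"
      by (simp add: q_def)
    ultimately have "q * exp (y / 2) \<le> 1"
      by (meson mult_left_mono order_trans)
    then show ?thesis
      by (simp add: exp_minus field_simps)
  qed
  then show ?thesis
    unfolding q_def S_def goal_eq[unfolded N_def] .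
qed

section \<open>Invariant frames in the plane and the norm of the iterates\<close>

text \<open>The determinant of the matrix with columns \<open>u\<close> and \<open>v\<close>; it is
  nonzero exactly when the two lines are transversal.\<close>

definition wedge :: "real^2 \<Rightarrow> real^2 \<Rightarrow> real" where
  "wedge u v = u $ 1 * v $ 2 - u $ 2 * v $ 1"

definition eigenframe :: "('a \<Rightarrow> mat2) \<Rightarrow> real^2 \<Rightarrow> real^2 \<Rightarrow> ('a \<Rightarrow> real) \<Rightarrow> ('a \<Rightarrow> real) \<Rightarrow> bool"
  where "eigenframe D u v a b \<longleftrightarrow> wedge u v \<noteq> 0 \<and>
    (\<forall>j. D j *v u = a j *\<^sub>R u \<and> D j *v v = b j *\<^sub>R v \<and> \<bar>a j * b j\<bar> = 1)"

lemma wedge_scaleR: "wedge (r *\<^sub>R u) (s *\<^sub>R v) = r * s * wedge u v"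
  by (simp add: wedge_def algebra_simps)

lemma wedge_matrix_vector_mult: "wedge (M *v u) (M *v v) = det M * wedge u v"
  by (simp add: wedge_def det_2 matrix_vector_mult_def sum_2 algebra_simps)

lemma wedge_trace: "wedge (M *v u) v + wedge u (M *v v) = trace M * wedge u v"
  by (simp add: wedge_def trace_def matrix_vector_mult_def sum_2 algebra_simps)

text \<open>Cramer's rule; the two summands are the projections onto the lines of the frame.\<close>

lemma wedge_decomposition:
  assumes "wedge u v \<noteq> 0"
  shows "w = (wedge w v / wedge u v) *\<^sub>R u + (wedge u w / wedge u v) *\<^sub>R v"
proof -
  have "wedge u v *\<^sub>R w = wedge w v *\<^sub>R u + wedge u w *\<^sub>R v"
    by (simp add: vec_eq_iff forall_2 wedge_def algebra_simps)
  then have "w = (1 / wedge u v) *\<^sub>R (wedge w v *\<^sub>R u + wedge u w *\<^sub>R v)"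
    using assms by (metis divideR_right divide_inverse_commute inverse_eq_divide mult_1_right)
  then show ?thesis
    by (simp add: scaleR_add_right)
qed

lemma abs_wedge_le: "\<bar>wedge u v\<bar> \<le> 2 * norm u * norm v"
proof -
  have "\<bar>wedge u v\<bar> \<le> \<bar>u $ 1\<bar> * \<bar>v $ 2\<bar> + \<bar>u $ 2\<bar> * \<bar>v $ 1\<bar>"
    unfolding wedge_def by (metis abs_mult abs_triangle_ineq4)
  also have "\<dots> \<le> norm u * norm v + norm u * norm v"
    by (intro add_mono mult_mono component_le_norm_cart) auto
  finally show ?thesis by simp
qed

lemma transversal_imp_wedge_nonzero:
  assumes "u \<noteq> 0" "v \<noteq> 0" "span {u} \<inter> span {v} = {0}"
  shows "wedge u v \<noteq> 0"
proof
  assume w: "wedge u v = 0"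
  have "\<exists>r. v = r *\<^sub>R u"
  proof (cases "u $ 1 = 0")
    case True
    then have "u $ 2 \<noteq> 0"
      using assms(1) by (auto simp: vec_eq_iff forall_2)
    then have "v = (v $ 2 / u $ 2) *\<^sub>R u"
      using w True by (auto simp: vec_eq_iff forall_2 wedge_def)
    then show ?thesis ..
  next
    case False
    then have "v = (v $ 1 / u $ 1) *\<^sub>R u"
      using w by (auto simp: vec_eq_iff forall_2 wedge_def field_simps)
    then show ?thesis ..
  qed
  then have "v \<in> span {u}"
    by (auto simp: span_singleton)
  then have "v \<in> span {u} \<inter> span {v}"
    by (simp add: span_base)
  then show False
    using assms by simp
qed

lemma Diag_imp_eigenframe:
  assumes "Diag D"
  obtains u v a b where "eigenframe D u v a b"
proof -
  obtain u v where uv: "u \<noteq> 0" "v \<noteq> 0" "span {u} \<inter> span {v} = {0}"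
    and inv: "\<forall>j. D j *v u \<in> span {u} \<and> D j *v v \<in> span {v}"
    and SL: "\<forall>j. SL2 (D j)"
    using assms unfolding Diag_def by (elim exE conjE)
  have "\<exists>a. \<forall>j. D j *v u = a j *\<^sub>R u" "\<exists>b. \<forall>j. D j *v v = b j *\<^sub>R v"
    using inv unfolding span_singleton by (intro choice, blast)+
  then obtain a b where ab: "\<And>j. D j *v u = a j *\<^sub>R u" "\<And>j. D j *v v = b j *\<^sub>R v"
    by auto
  have w: "wedge u v \<noteq> 0"
    using transversal_imp_wedge_nonzero[OF uv] .
  have "\<bar>a j * b j\<bar> = 1" for j
  proof -
    have "a j * b j = det (D j)"
      using wedge_matrix_vector_mult[of "D j" u v] w by (simp add: ab wedge_scaleR)
    then show ?thesis
      using SL by (metis SL2_def abs_1 abs_minus_cancel)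
  qed
  with ab w have "eigenframe D u v a b"
    by (simp add: eigenframe_def)
  then show ?thesis
    by (rule that)
qed

lemma norm_matrix_vector_le_opnorm: "norm (M *v w) \<le> opnorm M * norm w"
  unfolding opnorm_def by (rule onorm[OF matrix_vector_mul_bounded_linear])

lemma eigenvalue_le_opnorm:
  assumes "M *v u = r *\<^sub>R u" "u \<noteq> 0"
  shows "\<bar>r\<bar> \<le> opnorm M"
  using norm_matrix_vector_le_opnorm[of M u] assms by simp

lemma opnorm_triangle: "opnorm (M + N) \<le> opnorm M + opnorm N"
  unfolding opnorm_def matrix_vector_mult_add_rdistrib
  by (intro onorm_triangle matrix_vector_mul_bounded_linear)

lemma wedge_nonzero:
  assumes "wedge u v \<noteq> 0"
  shows "u \<noteq> 0" "v \<noteq> 0"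
  using assms by (auto simp: wedge_def)

text \<open>The eigenvalue gap becomes a polynomial in the matrix entries. It is thus continuous in
  the matrix and independent of the frame, so nearby cocycles can be compared without comparing
  their frames.\<close>

lemma eigenframe_discriminant:
  assumes "eigenframe D u v a b"
  shows "(a j - b j)\<^sup>2 = (trace (D j))\<^sup>2 - 4 * det (D j)"
proof -
  have w: "wedge u v \<noteq> 0" and ev: "D j *v u = a j *\<^sub>R u" "D j *v v = b j *\<^sub>R v"
    using assms by (auto simp: eigenframe_def)
  have "det (D j) = a j * b j"
    using wedge_matrix_vector_mult[of "D j" u v] w by (simp add: ev wedge_scaleR)
  moreover have "trace (D j) = a j + b j"
    using wedge_trace[of "D j" u v] w wedge_scaleR[of "a j" u 1 v] wedge_scaleR[of 1 u "b j" v]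
    by (simp add: ev flip: distrib_right)
  ultimately show ?thesis
    by (simp add: power2_eq_square algebra_simps)
qed

lemma coc_iter_eigenvector:
  assumes "\<And>j. D j *v u = a j *\<^sub>R u"
  shows "coc_iter D n x *v u = (\<Prod>i<n. a (x (int i))) *\<^sub>R u"
  by (induction n)
    (simp_all add: assms matrix_vector_mul_assoc[symmetric] matrix_vector_mult_scaleR mult.commute)

lemma abs_prod_eq_exp_sum_ln:
  fixes f :: "'i \<Rightarrow> real"
  assumes "finite I" "\<And>i. i \<in> I \<Longrightarrow> f i \<noteq> 0"
  shows "\<bar>\<Prod>i\<in>I. f i\<bar> = exp (\<Sum>i\<in>I. ln \<bar>f i\<bar>)"
  using assms by (simp add: abs_prod exp_sum)

text \<open>The error depends on \<open>k\<close> alone, not on \<open>n\<close> or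
  \<open>x\<close>. The projection bound \<open>k\<close> is abstract because it has two sources:
  the angle of the frame for the exponent of one cocycle, and the eigenvalue gap for estimates
  uniform near \<open>A\<close>.\<close>

lemma ln_opnorm_coc_iter_bounds:
  fixes n :: nat
  assumes fr: "eigenframe D u v a b" and k: "k \<ge> 0"
    and proj: "\<And>w. norm ((wedge w v / wedge u v) *\<^sub>R u) \<le> k * norm w"
  defines "S \<equiv> (\<lambda>x. \<Sum>i<n. ln \<bar>a (x (int i))\<bar>)"
  shows "\<bar>S x\<bar> \<le> ln (opnorm (coc_iter D n x))"
    and "ln (opnorm (coc_iter D n x)) \<le> \<bar>S x\<bar> + ln (2 * k + 1)"
proof -
  have w: "wedge u v \<noteq> 0" and ev: "\<And>j. D j *v u = a j *\<^sub>R u" "\<And>j. D j *v v = b j *\<^sub>R v"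
    and ab: "\<And>j. \<bar>a j * b j\<bar> = 1"
    using fr by (auto simp: eigenframe_def)
  have nz: "a j \<noteq> 0" "b j \<noteq> 0" for j
    using ab[of j] by auto
  have ln_b: "ln \<bar>b j\<bar> = - ln \<bar>a j\<bar>" for j
    using ab[of j] nz[of j] ln_mult[of "\<bar>a j\<bar>" "\<bar>b j\<bar>"] by (simp add: abs_mult)
  define \<alpha> where "\<alpha> = (\<Prod>i<n. a (x (int i)))"
  define \<beta> where "\<beta> = (\<Prod>i<n. b (x (int i)))"
  have \<alpha>: "\<bar>\<alpha>\<bar> = exp (S x)"
    unfolding \<alpha>_def S_def by (rule abs_prod_eq_exp_sum_ln) (auto simp: nz)
  have \<beta>: "\<bar>\<beta>\<bar> = exp (- S x)"
    unfolding \<beta>_def S_def by (subst abs_prod_eq_exp_sum_ln) (auto simp: nz ln_b sum_negf)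
  note iter = coc_iter_eigenvector[of D u a n x, OF ev(1), folded \<alpha>_def]
    coc_iter_eigenvector[of D v b n x, OF ev(2), folded \<beta>_def]
  let ?N = "opnorm (coc_iter D n x)"
  \<comment> \<open>Both frame vectors are eigenvectors of the iterate, with eigenvalues of these
    moduli.\<close>
  have "exp (S x) \<le> ?N" "exp (- S x) \<le> ?N"
    using eigenvalue_le_opnorm[OF iter(1)] eigenvalue_le_opnorm[OF iter(2)] wedge_nonzero[OF w]
    by (simp_all add: \<alpha> \<beta>)
  then have lower: "exp \<bar>S x\<bar> \<le> ?N"
    by (auto simp: abs_if)
  then have pos: "?N > 0"
    by (meson exp_gt_zero less_le_trans)
  with lower show "\<bar>S x\<bar> \<le> ln ?N"
    by (simp add: ln_ge_iff)
  \<comment> \<open>The components of a vector have norms at most \<open>k\<close> and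
    \<open>k + 1\<close> times its own, the second by the triangle inequality, and each is stretched
    by at most \<open>exp \<bar>S x\<bar>\<close>.\<close>
  have "?N \<le> (2 * k + 1) * exp \<bar>S x\<bar>"
    unfolding opnorm_def
  proof (rule onorm_le)
    fix y
    define p where "p = (wedge y v / wedge u v) *\<^sub>R u"
    define q where "q = (wedge u y / wedge u v) *\<^sub>R v"
    have y: "y = p + q"
      unfolding p_def q_def by (rule wedge_decomposition[OF w])
    have np: "norm p \<le> k * norm y"
      unfolding p_def by (rule proj)
    have "norm q \<le> norm y + norm p"
      using norm_triangle_ineq4[of y p] y by simp
    with np have nq: "norm q \<le> (k + 1) * norm y"
      by (simp add: algebra_simps)
    have "coc_iter D n x *v p = \<alpha> *\<^sub>R p" "coc_iter D n x *v q = \<beta> *\<^sub>R q"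
      by (simp_all add: p_def q_def matrix_vector_mult_scaleR iter)
    then have "coc_iter D n x *v y = \<alpha> *\<^sub>R p + \<beta> *\<^sub>R q"
      by (subst y) (simp only: matrix_vector_right_distrib)
    then have "norm (coc_iter D n x *v y) \<le> \<bar>\<alpha>\<bar> * norm p + \<bar>\<beta>\<bar> * norm q"
      by (metis norm_scaleR norm_triangle_ineq)
    also have "\<dots> \<le> exp \<bar>S x\<bar> * (k * norm y) + exp \<bar>S x\<bar> * ((k + 1) * norm y)"
      unfolding \<alpha> \<beta> using np nq by (intro add_mono mult_mono) auto
    finally show "norm (coc_iter D n x *v y) \<le> (2 * k + 1) * exp \<bar>S x\<bar> * norm y"
      by (simp add: algebra_simps)
  qed
  then have "ln ?N \<le> ln ((2 * k + 1) * exp \<bar>S x\<bar>)"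
    using pos k by (subst ln_le_cancel_iff) auto
  also have "\<dots> = \<bar>S x\<bar> + ln (2 * k + 1)"
    using k by (subst ln_mult) auto
  finally show "ln ?N \<le> \<bar>S x\<bar> + ln (2 * k + 1)" .
qed

lemma eigenframe_projection_bound:
  assumes "wedge u v \<noteq> 0"
  shows "norm ((wedge w v / wedge u v) *\<^sub>R u) \<le> 2 * norm v * norm u / \<bar>wedge u v\<bar> * norm w"
proof -
  have "\<bar>wedge w v\<bar> * norm u / \<bar>wedge u v\<bar> \<le> 2 * norm w * norm v * norm u / \<bar>wedge u v\<bar>"
    by (intro divide_right_mono mult_right_mono abs_wedge_le) auto
  then show ?thesis
    by (simp add: mult_ac)
qed

text \<open>The projection onto the first line along the second is \<open>(D j - b j) / (a j - b j)\<close>.\<close>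

lemma eigenframe_projection_bound_gap:
  assumes fr: "eigenframe D u v a b" and g: "g > 0" "\<bar>a j - b j\<bar> \<ge> g" and R: "opnorm (D j) \<le> R"
  shows "norm ((wedge w v / wedge u v) *\<^sub>R u) \<le> 2 * R / g * norm w"
proof -
  have w: "wedge u v \<noteq> 0" and ev: "D j *v u = a j *\<^sub>R u" "D j *v v = b j *\<^sub>R v"
    using fr by (auto simp: eigenframe_def)
  define p where "p = (wedge w v / wedge u v) *\<^sub>R u"
  define q where "q = (wedge u w / wedge u v) *\<^sub>R v"
  have "D j *v p = a j *\<^sub>R p" "D j *v q = b j *\<^sub>R q"
    by (simp_all add: p_def q_def matrix_vector_mult_scaleR ev)
  then have "(a j - b j) *\<^sub>R p = D j *v (p + q) - b j *\<^sub>R (p + q)"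
    by (simp only: matrix_vector_right_distrib) (simp add: algebra_simps)
  moreover have "p + q = w"
    unfolding p_def q_def by (rule wedge_decomposition[OF w, symmetric])
  ultimately have eq: "(a j - b j) *\<^sub>R p = D j *v w - b j *\<^sub>R w"
    by simp
  have b: "\<bar>b j\<bar> \<le> R"
    using eigenvalue_le_opnorm[OF ev(2)] wedge_nonzero[OF w] R by simp
  have "g * norm p \<le> norm ((a j - b j) *\<^sub>R p)"
    using g by (simp add: mult_right_mono)
  also have "\<dots> \<le> norm (D j *v w) + norm (b j *\<^sub>R w)"
    unfolding eq by (rule norm_triangle_ineq4)
  also have "\<dots> \<le> R * norm w + R * norm w"
    using b order_trans[OF norm_matrix_vector_le_opnorm mult_right_mono[OF R]]
    by (intro add_mono) (auto intro: mult_right_mono)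
  finally show ?thesis
    using g by (simp add: p_def[symmetric] field_simps)
qed

lemma discriminant_opnorm_continuous:
  fixes M :: mat2
  assumes "(trace M)\<^sup>2 - 4 * det M > d"
  obtains \<delta> where "\<delta> > 0" "\<And>N. opnorm (N - M) < \<delta> \<Longrightarrow> (trace N)\<^sup>2 - 4 * det N > d"
proof -
  let ?f = "\<lambda>N :: mat2. (trace N)\<^sup>2 - 4 * det N"
  have "isCont ?f M"
    unfolding trace_def det_2 by (intro continuous_intros)
  then have "(?f \<longlongrightarrow> ?f M) (nhds M)"
    using tendsto_at_iff_tendsto_nhds[of ?f M] by (simp add: isCont_def)
  then have "\<forall>\<^sub>F N in nhds M. ?f N > d"
    using assms by (rule order_tendstoD(1))
  then obtain e where e: "e > 0" "\<And>N. dist N M < e \<Longrightarrow> ?f N > d"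
    by (auto simp: eventually_nhds_metric)
  \<comment> \<open>The Euclidean norm is at most the sum of the moduli of the four entries, each
    bounded by the operator norm.\<close>
  have "dist N M < e" if "opnorm (N - M) < e / 4" for N
  proof -
    have c: "\<bar>(N - M) $ i $ j\<bar> \<le> opnorm (N - M)" for i j
      unfolding opnorm_def by (rule matrix_component_le_onorm)
    have "norm (N - M) \<le> (\<Sum>i\<in>UNIV. norm ((N - M) $ i))"
      unfolding norm_vec_def by (rule L2_set_le_sum) simp
    also have "\<dots> \<le> (\<Sum>i\<in>UNIV. \<Sum>j\<in>UNIV. \<bar>(N - M) $ i $ j\<bar>)"
      by (intro sum_mono norm_le_l1_cart)
    also have "\<dots> \<le> (\<Sum>i\<in>(UNIV::2 set). \<Sum>j\<in>(UNIV::2 set). opnorm (N - M))"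
      by (intro sum_mono c)
    also have "\<dots> < e"
      using that by simp
    finally show ?thesis
      by (simp add: dist_norm)
  qed
  with e show ?thesis
    by (intro that[of "e / 4"]) auto
qed

section \<open>Sums of a function of the letters under the Bernoulli measure\<close>

lemma prob_space_bern: "prob_space (bern p)"
  unfolding bern_def by (intro prob_space_PiM) (rule measure_pmf.prob_space_axioms)

lemma measurable_bern_coordinate [measurable]:
  "(\<lambda>x. g (x i)) \<in> borel_measurable (bern p)" for g :: "'a \<Rightarrow> real"
  unfolding bern_def
  by (rule measurable_compose[OF measurable_component_singleton]) simp_all

lemma distr_bern_coordinate:
  "distr (bern p) (measure_pmf p) (\<lambda>x. x i) = measure_pmf p"
  unfolding bern_def
  by (rule distr_PiM_component) (auto intro: measure_pmf.prob_space_axioms)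

lemma expectation_bern_coordinate:
  fixes g :: "'a \<Rightarrow> real"
  shows "(\<integral>x. g (x i) \<partial>bern p) = measure_pmf.expectation p g"
proof -
  have "measure_pmf.expectation p g = (\<integral>y. g y \<partial>distr (bern p) (measure_pmf p) (\<lambda>x. x i))"
    by (simp add: distr_bern_coordinate)
  also have "\<dots> = (\<integral>x. g (x i) \<partial>bern p)"
    by (rule integral_distr) (simp_all add: bern_def)
  finally show ?thesis ..
qed

text \<open>Reindexing the product measure along the injection \<open>int\<close> yields the product
  measure over the naturals, so the joint law of these coordinates is the product of their
  laws.\<close>

lemma indep_vars_bern_coordinates:
  fixes g :: "'a \<Rightarrow> real"
  shows "prob_space.indep_vars (bern p) (\<lambda>_. borel) (\<lambda>i x. g (x (int i))) I"
proof -
  interpret prob_space "bern p"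
    by (rule prob_space_bern)
  have "indep_vars (\<lambda>_. measure_pmf p) (\<lambda>i x. x (int i)) (UNIV :: nat set)"
  proof (subst indep_vars_iff_distr_eq_PiM')
    show "random_variable (measure_pmf p) (\<lambda>x. x (int i))" for i
      unfolding bern_def by measurable
    have "distr (bern p) (Pi\<^sub>M (UNIV :: nat set) (\<lambda>_. measure_pmf p))
        (\<lambda>x. \<lambda>i\<in>UNIV. x (int i)) = Pi\<^sub>M UNIV (\<lambda>_. measure_pmf p)"
      unfolding bern_def
      by (rule distr_PiM_reindex) (auto intro: measure_pmf.prob_space_axioms)
    then show "distr (bern p) (Pi\<^sub>M (UNIV :: nat set) (\<lambda>_. measure_pmf p))
        (\<lambda>x. \<lambda>i\<in>UNIV. x (int i)) =
        Pi\<^sub>M UNIV (\<lambda>i. distr (bern p) (measure_pmf p) (\<lambda>x. x (int i)))"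
      by (simp add: distr_bern_coordinate)
  qed simp
  then have "indep_vars (\<lambda>_. borel) (\<lambda>i x. g (x (int i))) (UNIV :: nat set)"
    by (rule indep_vars_compose2[where Y = "\<lambda>_. g"]) simp
  then show ?thesis
    by (rule indep_vars_subset) simp
qed

text \<open>Centring turns the bound \<open>R\<close> into \<open>2 * R\<close>, whence the
  constants 4 and 32 in place of 2 and 8.\<close>

lemma bern_sum_concentration:
  fixes g :: "'a \<Rightarrow> real"
  assumes bnd: "\<And>j. \<bar>g j\<bar> \<le> R" and R: "R > 0" and n: "n > 0" and s: "s \<ge> 4 * R"
  shows "measure (bern p) {x \<in> space (bern p).
      \<bar>(\<Sum>i<n. g (x (int i))) - real n * measure_pmf.expectation p g\<bar> > s}
    \<le> exp (- (s\<^sup>2 / (32 * real n * R\<^sup>2)))"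
proof -
  interpret prob_space "bern p"
    by (rule prob_space_bern)
  define \<mu> where "\<mu> = measure_pmf.expectation p g"
  have int: "integrable (bern p) (\<lambda>x. g (x (int i)))" for i
    using bnd by (intro integrable_const_bound[where B = R]) auto
  have "integrable (measure_pmf p) g"
    using bnd by (intro measure_pmf.integrable_const_bound[where B = R]) auto
  then have "\<mu> \<le> R" "- R \<le> \<mu>"
    unfolding \<mu>_def using bnd
    by (auto intro!: measure_pmf.integral_le_const measure_pmf.integral_ge_const
        simp: abs_le_iff minus_le_iff)
  then have bnd': "\<bar>g j - \<mu>\<bar> \<le> 2 * R" for j
    using bnd[of j] by linarith
  have eq: "(\<Sum>i<n. g (x (int i))) - real n * \<mu> = (\<Sum>i<n. g (x (int i)) - \<mu>)" for x
    by (simp add: sum_subtractf)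
  have "prob {x \<in> space (bern p). \<bar>\<Sum>i<n. g (x (int i)) - \<mu>\<bar> > s}
      \<le> exp (- (s\<^sup>2 / (8 * real (card {..<n}) * (2 * R)\<^sup>2)))"
  proof (rule centred_sum_concentration)
    show "indep_vars (\<lambda>_. borel) (\<lambda>i x. g (x (int i)) - \<mu>) {..<n}"
      by (rule indep_vars_bern_coordinates)
    show "expectation (\<lambda>x. g (x (int i)) - \<mu>) = 0" for i
      using int[of i] by (simp add: expectation_bern_coordinate \<mu>_def prob_space)
  qed (use bnd' R n s in auto)
  then show ?thesis
    by (simp add: eq \<mu>_def[symmetric] power_mult_distrib mult.assoc)
qed

text \<open>The strong law of large numbers: the exponential tail bounds are summable, so
  Borel-Cantelli applies for each tolerance.\<close>

lemma AE_bern_mean_tendsto: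
  fixes g :: "'a \<Rightarrow> real"
  assumes bnd: "\<And>j. \<bar>g j\<bar> \<le> R"
  shows "AE x in bern p. (\<lambda>n. (\<Sum>i<n. g (x (int i))) / real n)
           \<longlonglongrightarrow> measure_pmf.expectation p g"
proof -
  interpret prob_space "bern p"
    by (rule prob_space_bern)
  define \<mu> where "\<mu> = measure_pmf.expectation p g"
  \<comment> \<open>\<open>R\<close> may be 0, while the concentration bound asks for a positive
    constant.\<close>
  define B where "B = R + 1"
  have B: "B > 0" "\<bar>g j\<bar> \<le> B" for j
    using bnd[of j] by (auto simp: B_def)
  define S where "S = (\<lambda>n x. \<Sum>i<n. g (x (int i)))"
  have S_meas [measurable]: "S n \<in> borel_measurable (bern p)" for n
    unfolding S_def by measurable
  have ev: "AE x in bern p. \<forall>\<^sub>F n in sequentially. \<bar>S n x - real n * \<mu>\<bar> \<le> e * real n"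
    if e: "e > 0" for e
  proof -
    define A where "A = (\<lambda>n. {x \<in> space (bern p). \<bar>S n x - real n * \<mu>\<bar> > e * real n})"
    define r where "r = exp (- (e\<^sup>2 / (32 * B\<^sup>2)))"
    have "AE x in bern p. \<forall>\<^sub>F n in sequentially. x \<in> space (bern p) - A n"
    proof (rule borel_cantelli_AE1)
      show "A n \<in> sets (bern p)" for n
        unfolding A_def by measurable
      show "emeasure (bern p) (A n) < \<infinity>" for n
        by (simp add: emeasure_eq_measure)
      \<comment> \<open>The threshold gives e n >= 4B, and the added 1 gives n > 0.\<close>
      have bound: "norm (prob (A n)) \<le> r ^ n" if n: "n \<ge> nat \<lceil>4 * B / e\<rceil> + 1" for n
      proof -
        have "4 * B / e \<le> real n"
          using n by linarith
        then have "prob (A n) \<le> exp (- ((e * real n)\<^sup>2 / (32 * real n * B\<^sup>2)))"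
          unfolding A_def S_def \<mu>_def using B n e
          by (intro bern_sum_concentration) (auto simp: field_simps)
        also have "(e * real n)\<^sup>2 / (32 * real n * B\<^sup>2) = real n * (e\<^sup>2 / (32 * B\<^sup>2))"
          using n by (simp add: power2_eq_square)
        also have "exp (- (real n * (e\<^sup>2 / (32 * B\<^sup>2)))) = r ^ n"
          by (simp add: r_def flip: exp_of_nat_mult)
        finally show ?thesis by simp
      qed
      have "summable (\<lambda>n. r ^ n)"
        using e B by (intro summable_geometric) (simp add: r_def)
      then show "summable (\<lambda>n. prob (A n))"
        using bound by (rule summable_comparison_test')
    qed
    then show ?thesis
    proof eventually_elim
      case (elim x)
      then show ?case
        by (rule eventually_mono) (auto simp: A_def not_less)
    qed
  qed
  \<comment> \<open>Countably many tolerances 1/(m+1) keep the exceptional set null.\<close>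
  have "AE x in bern p. \<forall>m. \<forall>\<^sub>F n in sequentially.
      \<bar>S n x - real n * \<mu>\<bar> \<le> (1 / real (Suc m)) * real n"
    unfolding AE_all_countable by (intro allI ev) simp
  then show ?thesis
  proof eventually_elim
    case (elim x)
    have "(\<lambda>n. S n x / real n) \<longlonglongrightarrow> \<mu>"
    proof (rule tendstoI)
      fix e :: real assume "e > 0"
      then obtain m where m: "1 / real (Suc m) < e"
        using nat_approx_posE by blast
      have "\<forall>\<^sub>F n in sequentially. \<bar>S n x - real n * \<mu>\<bar> \<le> (1 / real (Suc m)) * real n \<and> n > 0"
        using elim by (auto intro: eventually_conj eventually_gt_at_top)
      then show "\<forall>\<^sub>F n in sequentially. dist (S n x / real n) \<mu> < e"
      proof eventually_elim
        case (elim n)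
        then have "S n x / real n - \<mu> = (S n x - real n * \<mu>) / real n"
          by (simp add: field_simps)
        then have "dist (S n x / real n) \<mu> = \<bar>S n x - real n * \<mu>\<bar> / real n"
          by (simp add: dist_real_def)
        also have "\<dots> \<le> 1 / real (Suc m)"
          using elim by (simp add: field_simps)
        finally show ?case
          using m by linarith
      qed
    qed
    then show ?case
      by (simp add: S_def \<mu>_def)
  qed
qed

section \<open>The Lyapunov exponent and the uniform estimate\<close>

text \<open>The logarithm of the norm differs from the modulus of the Birkhoff sum by a bounded
  amount, which vanishes after division by \<open>n\<close>; the strong law does the rest.\<close>

lemma lyap_eigenframe:
  fixes p :: "'a::finite pmf"
  assumes fr: "eigenframe D u v a b"
  shows "lyap p D = \<bar>measure_pmf.expectation p (\<lambda>j. ln \<bar>a j\<bar>)\<bar>"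
proof -
  interpret prob_space "bern p"
    by (rule prob_space_bern)
  define g where "g = (\<lambda>j. ln \<bar>a j\<bar>)"
  define k where "k = 2 * norm v * norm u / \<bar>wedge u v\<bar>"
  have k: "k \<ge> 0"
    by (simp add: k_def)
  have "wedge u v \<noteq> 0"
    using fr by (simp add: eigenframe_def)
  then have proj: "norm ((wedge w v / wedge u v) *\<^sub>R u) \<le> k * norm w" for w
    unfolding k_def by (rule eigenframe_projection_bound)
  note bounds = ln_opnorm_coc_iter_bounds[OF fr k proj]
  have bnd: "\<bar>g j\<bar> \<le> Max (range (\<lambda>j. \<bar>g j\<bar>))" for j
    by (intro Max_ge) auto
  have AE: "AE x in bern p. (\<lambda>n. ln (opnorm (coc_iter D n x)) / real n)
      \<longlonglongrightarrow> \<bar>measure_pmf.expectation p g\<bar>"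
    using AE_bern_mean_tendsto[of g, OF bnd]
  proof eventually_elim
    case (elim x)
    let ?S = "\<lambda>n. \<Sum>i<n. g (x (int i))"
    have lim: "(\<lambda>n. \<bar>?S n / real n\<bar>) \<longlonglongrightarrow> \<bar>measure_pmf.expectation p g\<bar>"
      using elim by (rule tendsto_rabs)
    have "(\<lambda>n. \<bar>?S n / real n\<bar> + ln (2 * k + 1) / real n)
        \<longlonglongrightarrow> \<bar>measure_pmf.expectation p g\<bar> + 0"
      by (intro tendsto_add lim lim_const_over_n)
    then have lim': "(\<lambda>n. \<bar>?S n / real n\<bar> + ln (2 * k + 1) / real n)
        \<longlonglongrightarrow> \<bar>measure_pmf.expectation p g\<bar>"
      by simp
    show ?case
    proof (rule tendsto_sandwich[OF _ _ lim lim'])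
      show "\<forall>\<^sub>F n in sequentially. \<bar>?S n / real n\<bar> \<le> ln (opnorm (coc_iter D n x)) / real n"
        using bounds(1) by (intro always_eventually) (simp add: g_def divide_right_mono)
      show "\<forall>\<^sub>F n in sequentially. ln (opnorm (coc_iter D n x)) / real n
          \<le> \<bar>?S n / real n\<bar> + ln (2 * k + 1) / real n"
        using bounds(2)
        by (intro always_eventually) (simp add: g_def divide_right_mono flip: add_divide_distrib)
    qed
  qed
  have "lyap p D = \<bar>measure_pmf.expectation p g\<bar>"
    unfolding lyap_def
  proof (rule the_equality)
    \<comment> \<open>An equality of constants that holds almost everywhere in a probability space
      holds outright.\<close>
    fix l assume "AE x in bern p. (\<lambda>n. ln (opnorm (coc_iter D n x)) / real n) \<longlonglongrightarrow> l"
    with AE have "AE x in bern p. l = \<bar>measure_pmf.expectation p g\<bar>"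
      by eventually_elim (rule LIMSEQ_unique)
    then show "l = \<bar>measure_pmf.expectation p g\<bar>"
      by simp
  qed (rule AE)
  then show ?thesis
    by (simp add: g_def)
qed

theorem theorem2p8:
  fixes p :: "'a::finite pmf" and A :: "'a \<Rightarrow> mat2"
  assumes "set_pmf p = UNIV"
    and "Diag A"
    and "lyap p A > 0"
  shows "\<exists>\<delta>>0. \<exists>c>0. \<exists>C::real. \<forall>D. Diag D \<and> coc_dist D A < \<delta> \<longrightarrow>
           (\<forall>\<epsilon>>0. \<forall>n::nat. real n \<ge> C / \<epsilon> \<longrightarrow>
              measure (bern p) {x \<in> space (bern p).
                 \<bar>ln (opnorm (coc_iter D n x)) / real n - lyap p D\<bar> > \<epsilon>}
              \<le> exp (- c * \<epsilon>\<^sup>2 * real n))"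
proof -
  obtain uA vA aA bA where frA: "eigenframe A uA vA aA bA"
    using Diag_imp_eigenframe[OF \<open>Diag A\<close>] .
  \<comment> \<open>Otherwise every \<open>ln \<bar>aA j\<bar>\<close> vanishes and the exponent is
    0.\<close>
  have "\<exists>j. \<bar>aA j\<bar> \<noteq> 1"
  proof (rule ccontr)
    assume "\<not> ?thesis"
    then show False
      using \<open>lyap p A > 0\<close> by (simp add: lyap_eigenframe[OF frA])
  qed
  then obtain j where "\<bar>aA j\<bar> \<noteq> 1" ..
  moreover have "\<bar>aA j * bA j\<bar> = 1"
    using frA by (simp add: eigenframe_def)
  ultimately have "aA j \<noteq> bA j"
    by (auto simp: abs_mult abs_square_eq_1 simp flip: power2_eq_square)
  then have d: "(aA j - bA j)\<^sup>2 > (\<bar>aA j - bA j\<bar> / 2)\<^sup>2"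
    by (simp add: power_divide)
  \<comment> \<open>Half the gap: the discriminant of \<open>A j\<close> is 4 g^2, so the strict
    bound by g^2 persists under small perturbations.\<close>
  define g where "g = \<bar>aA j - bA j\<bar> / 2"
  have g: "g > 0"
    using \<open>aA j \<noteq> bA j\<close> by (simp add: g_def)
  obtain \<delta> where \<delta>: "\<delta> > 0"
    "\<And>N. opnorm (N - A j) < \<delta> \<Longrightarrow> (trace N)\<^sup>2 - 4 * det N > g\<^sup>2"
    using discriminant_opnorm_continuous[of "g\<^sup>2" "A j"] d eigenframe_discriminant[OF frA, of j]
    unfolding g_def by auto
  \<comment> \<open>The added 1 covers every cocycle within distance 1 of \<open>A\<close>.\<close>
  define R where "R = Max (range (\<lambda>i. opnorm (A i))) + 1"
  define k where "k = 2 * R / g"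
  \<comment> \<open>The first entry makes \<epsilon> n / 2 at least 4R, as concentration requires;
    the second keeps the frame error below \<epsilon> n / 2.\<close>
  define C where "C = max (8 * R) (2 * ln (2 * k + 1))"
  have A_le: "opnorm (A i) + 1 \<le> R" for i
    unfolding R_def by (intro add_right_mono Max_ge) auto
  have "0 \<le> opnorm (A j)"
    unfolding opnorm_def by (intro onorm_pos_le matrix_vector_mul_bounded_linear)
  with A_le[of j] have R: "R \<ge> 1"
    by linarith
  then have k: "k \<ge> 0"
    using g by (simp add: k_def)
  have main: "measure (bern p) {x \<in> space (bern p).
        \<bar>ln (opnorm (coc_iter D n x)) / real n - lyap p D\<bar> > \<epsilon>}
      \<le> exp (- (1 / (128 * R\<^sup>2)) * \<epsilon>\<^sup>2 * real n)"
    if D: "Diag D" "coc_dist D A < min \<delta> 1" and \<epsilon>: "\<epsilon> > 0" and n: "real n \<ge> C / \<epsilon>"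
    for D \<epsilon> and n :: nat
  proof -
    interpret prob_space "bern p"
      by (rule prob_space_bern)
    obtain u v a b where fr: "eigenframe D u v a b"
      using Diag_imp_eigenframe[OF D(1)] .
    have dist: "opnorm (D i - A i) < min \<delta> 1" for i
    proof -
      have "opnorm (D i - A i) \<le> coc_dist D A"
        unfolding coc_dist_def by (intro Max_ge) auto
      with D(2) show ?thesis by simp
    qed
    have D_le: "opnorm (D i) \<le> R" for i
      using opnorm_triangle[of "D i - A i" "A i"] dist[of i] A_le[of i] by simp
    have "g\<^sup>2 \<le> \<bar>a j - b j\<bar>\<^sup>2"
      using \<delta>(2)[of "D j"] dist[of j] eigenframe_discriminant[OF fr, of j] by simp
    then have gap: "g \<le> \<bar>a j - b j\<bar>"
      by (rule power2_le_imp_le) simp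
    note bounds = ln_opnorm_coc_iter_bounds[OF fr k
        eigenframe_projection_bound_gap[OF fr g gap D_le, folded k_def]]
    define h where "h = (\<lambda>i. ln \<bar>a i\<bar>)"
    define \<mu> where "\<mu> = measure_pmf.expectation p h"
    have lyap: "lyap p D = \<bar>\<mu>\<bar>"
      by (simp add: lyap_eigenframe[OF fr] \<mu>_def h_def)
    \<comment> \<open>Both eigenvalues are at most \<open>R\<close> in modulus and their logarithms
      are opposite, so the upper bound for one is the lower bound for the other.\<close>
    have h_le: "\<bar>h i\<bar> \<le> R" for i
    proof -
      have w: "u \<noteq> 0" "v \<noteq> 0" and ev: "D i *v u = a i *\<^sub>R u" "D i *v v = b i *\<^sub>R v"
        and ab: "\<bar>a i\<bar> * \<bar>b i\<bar> = 1"
        using fr wedge_nonzero[of u v] by (auto simp: eigenframe_def abs_mult)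
      have le: "\<bar>a i\<bar> \<le> R" "\<bar>b i\<bar> \<le> R"
        using eigenvalue_le_opnorm[OF ev(1) w(1)] eigenvalue_le_opnorm[OF ev(2) w(2)] D_le[of i]
        by auto
      have pos: "\<bar>a i\<bar> > 0" "\<bar>b i\<bar> > 0"
        using ab by auto
      have "ln \<bar>a i\<bar> \<le> R" "ln \<bar>b i\<bar> \<le> R"
        using ln_le_minus_one[OF pos(1)] ln_le_minus_one[OF pos(2)] le by auto
      moreover have "ln \<bar>a i\<bar> + ln \<bar>b i\<bar> = 0"
        using ln_mult[of "\<bar>a i\<bar>" "\<bar>b i\<bar>"] pos ab by simp
      ultimately show ?thesis
        by (simp add: h_def abs_le_iff)
    qed
    have C: "C > 0" "8 * R \<le> C" "2 * ln (2 * k + 1) \<le> C"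
      using R by (auto simp: C_def)
    have n\<epsilon>: "C \<le> \<epsilon> * real n"
      using n \<epsilon> by (simp add: field_simps)
    with C have npos: "n > 0"
      by (intro gr0I) auto
    let ?S = "\<lambda>x. \<Sum>i<n. h (x (int i))"
    have "prob {x \<in> space (bern p). \<bar>ln (opnorm (coc_iter D n x)) / real n - lyap p D\<bar> > \<epsilon>}
        \<le> prob {x \<in> space (bern p). \<bar>?S x - real n * \<mu>\<bar> > \<epsilon> * real n / 2}"
    proof (rule finite_measure_mono)
      show "{x \<in> space (bern p). \<bar>?S x - real n * \<mu>\<bar> > \<epsilon> * real n / 2} \<in> events"
        by measurable
      show "{x \<in> space (bern p). \<bar>ln (opnorm (coc_iter D n x)) / real n - lyap p D\<bar> > \<epsilon>}
          \<subseteq> {x \<in> space (bern p). \<bar>?S x - real n * \<mu>\<bar> > \<epsilon> * real n / 2}"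
      proof safe
        fix x assume *: "\<bar>ln (opnorm (coc_iter D n x)) / real n - lyap p D\<bar> > \<epsilon>"
        let ?l = "ln (opnorm (coc_iter D n x))"
        have "?l / real n - lyap p D = (?l - real n * \<bar>\<mu>\<bar>) / real n"
          using npos by (simp add: lyap field_simps)
        with * have "\<epsilon> * real n < \<bar>?l - real n * \<bar>\<mu>\<bar>\<bar>"
          using npos by (simp add: field_simps)
        \<comment> \<open>Replacing \<open>?l\<close> by the modulus of the Birkhoff sum costs at
          most half of \<epsilon> n; the reverse triangle inequality then removes the
          moduli.\<close>
        moreover have "\<bar>?S x\<bar> \<le> ?l" "?l \<le> \<bar>?S x\<bar> + ln (2 * k + 1)"
          using bounds[where n = n and x = x] by (simp_all add: h_def)
        moreover have "\<bar>real n * \<mu>\<bar> = real n * \<bar>\<mu>\<bar>"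
          by (simp add: abs_mult)
        ultimately show "\<bar>?S x - real n * \<mu>\<bar> > \<epsilon> * real n / 2"
          using n\<epsilon> C by linarith
      qed
    qed
    also have "\<dots> \<le> exp (- ((\<epsilon> * real n / 2)\<^sup>2 / (32 * real n * R\<^sup>2)))"
      unfolding \<mu>_def using h_le R npos n\<epsilon> C by (intro bern_sum_concentration) auto
    also have "(\<epsilon> * real n / 2)\<^sup>2 / (32 * real n * R\<^sup>2) = (1 / (128 * R\<^sup>2)) * \<epsilon>\<^sup>2 * real n"
      using npos by (simp add: power2_eq_square)
    finally show ?thesis by simp
  qed
  have pos: "min \<delta> 1 > 0" "1 / (128 * R\<^sup>2) > 0"
    using \<delta>(1) R by auto
  show ?thesis
    by (intro exI[of _ "min \<delta> 1"] exI[of _ "1 / (128 * R\<^sup>2)"] exI[of _ C] conjI pos allI impI)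
      (blast intro: main)
qed

end
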